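(* Let $G=(V,E)$ be a finite simple graph with $V=\{1,\dots,n\}$, $n\ge1$, let $A$ be its adjacency matrix, and let $c\in\mathbb{R}$. Let $S\subseteq V$ be non-empty. Suppose there exists $\mathbf{x}\in\mathrm{KKT}(c)$ such that $S=\operatorname{supp}(\mathbf{x})$, and suppose $-c$ is not an eigenvalue of the principal submatrix $A[S,S]$. Then every class of the partition induced by $\mathbf{x}$ is invariant under every automorphism of $G[S]$.
   Context: Graphs are finite, undirected, unweighted, without loops. $I$ is the $n\times n$ identity matrix, $\mathbf 1$ the all-ones vector. $\Delta_n=\{\mathbf{x}\in\mathbb{R}^n:\mathbf{1}^\top\mathbf{x}=1,\ \mathbf{x}\ge\mathbf 0\}$ and $\operatorname{supp}(\mathbf{x})=\{i:x_i\ne0\}$. $A[S,S]$ is the submatrix of $A$ with rows and columns indexed by $S$; $G[S]$ is the subgraph induced by $S$. $\mathrm{KKT}(c)$ is the set of KKT points of the program $\max_{\mathbf{x}\in\Delta_n}\mathbf{x}^\top(A+cI)\mathbf{x}$: the set of $\mathbf{x}\in\Delta_n$ for which there exist $\mu_0\in\mathbb{R}$ and $\boldsymbol\mu\in\mathbb{R}^n$ with $2(A+cI)\mathbf{x}+\mu_0\mathbf{1}+\boldsymbol\mu=\mathbf 0$, $\mu_ix_i=0$ for every $i\in V$, and $\boldsymbol\mu\ge\mathbf 0$. The partition induced by $\mathbf{x}\in\Delta_n$ is the family of equivalence classes of the relation on $\operatorname{supp}(\mathbf{x})$ given by $i\sim_{\mathbf{x}}j$ if and only if $x_i=x_j$.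 *)

theory Defs
  imports "Jordan_Normal_Form.Char_Poly" "Jordan_Normal_Form.DL_Submatrix"
begin

text \<open>
  A graph is a pair of a vertex set and a set of edges, each edge being a two-element set of
  vertices. Graphs of order \<open>n\<close> have vertex set \<open>{0..<n}\<close>, so that vertices are exactly the
  indices of vectors and matrices of dimension \<open>n\<close>.
\<close>

type_synonym 'a graph = "'a set \<times> 'a set set"

abbreviation vertices :: "'a graph \<Rightarrow> 'a set" where
  "vertices G \<equiv> fst G"

abbreviation edges :: "'a graph \<Rightarrow> 'a set set" where
  "edges G \<equiv> snd G"

definition simple_graph :: "'a graph \<Rightarrow> bool" where
  "simple_graph G \<longleftrightarrow> finite (vertices G) \<and> (\<forall>e\<in>edges G. e \<subseteq> vertices G \<and> card e = 2)"

definition induced_subgraph :: "'a graph \<Rightarrow> 'a set \<Rightarrow> 'a graph" where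
  "induced_subgraph G S = (S, {e \<in> edges G. e \<subseteq> S})"

definition graph_automorphism :: "'a graph \<Rightarrow> ('a \<Rightarrow> 'a) \<Rightarrow> bool" where
  "graph_automorphism G f \<longleftrightarrow> bij_betw f (vertices G) (vertices G) \<and>
     (\<forall>u\<in>vertices G. \<forall>v\<in>vertices G. {f u, f v} \<in> edges G \<longleftrightarrow> {u, v} \<in> edges G)"

definition adjacency_matrix :: "nat \<Rightarrow> nat graph \<Rightarrow> real mat" where
  "adjacency_matrix n G = mat n n (\<lambda>(i, j). if {i, j} \<in> edges G then 1 else 0)"

definition all_ones :: "nat \<Rightarrow> real vec" where
  "all_ones n = vec n (\<lambda>_. 1)"

definition standard_simplex :: "nat \<Rightarrow> real vec set" where
  "standard_simplex n = {x \<in> carrier_vec n. all_ones n \<bullet> x = 1 \<and> (\<forall>i<n. 0 \<le> x $ i)}"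

definition vec_supp :: "real vec \<Rightarrow> nat set" where
  "vec_supp x = {i. i < dim_vec x \<and> x $ i \<noteq> 0}"

definition KKT :: "nat \<Rightarrow> real mat \<Rightarrow> real \<Rightarrow> real vec set" where
  "KKT n A c = {x \<in> standard_simplex n. \<exists>(\<mu>0 :: real). \<exists>\<mu> \<in> carrier_vec n.
     2 \<cdot>\<^sub>v ((A + c \<cdot>\<^sub>m 1\<^sub>m n) *\<^sub>v x) + \<mu>0 \<cdot>\<^sub>v all_ones n + \<mu> = 0\<^sub>v n \<and>
     (\<forall>i<n. \<mu> $ i * x $ i = 0) \<and> (\<forall>i<n. 0 \<le> \<mu> $ i)}"

definition induced_partition :: "real vec \<Rightarrow> nat set set" where
  "induced_partition x = vec_supp x // {(i, j) \<in> vec_supp x \<times> vec_supp x. x $ i = x $ j}"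

end

theory Submission
  imports Defs
begin

text \<open>
  On the support the multipliers vanish, so \<open>x\<close> solves \<open>(A[S,S] + c I) x = k 1\<close> for a constant
  \<open>k\<close>. Permuting \<open>x\<close> by an automorphism of \<open>G[S]\<close> gives another solution, and as \<open>-c\<close> is not an
  eigenvalue of \<open>A[S,S]\<close> the solution is unique. Hence \<open>x\<close> is constant on the orbits.
\<close>

text \<open>\<open>submatrix\<close> renumbers the rows and columns kept from \<open>S\<close>
  through \<open>pick S\<close>; this bijection turns sums over the new positions into sums over
  \<open>S\<close>. Its inverse sends an element to its rank in \<open>S\<close>.\<close>

lemma bij_betw_pick:
  assumes "finite S"
  shows "bij_betw (pick S) {0..<card S} S"
proof (rule bij_betw_byWitness[where f' = "\<lambda>j. card {a\<in>S. a < j}"])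
  show "(\<lambda>j. card {a\<in>S. a < j}) ` S \<subseteq> {0..<card S}"
    using assms by (auto intro!: psubset_card_mono)
qed (auto simp: pick_card_in_set card_pick_le pick_in_set_le)

lemma sum_submatrix_row:
  fixes A :: "'a :: semiring_0 mat"
  assumes A: "A \<in> carrier_mat n n" and S: "S \<subseteq> {0..<n}" and i: "i < card S"
  shows "(submatrix A S S *\<^sub>v vec (card S) (\<lambda>k. z (pick S k))) $ i
    = (\<Sum>j\<in>S. A $$ (pick S i, j) * z j)"
proof -
  \<comment> \<open>The size of a \<open>submatrix\<close> counts only indices below
    \<open>n\<close>; by \<open>S \<subseteq> {0..<n}\<close> none is lost, so it is
    \<open>card S\<close>.\<close>
  have S': "{i. i < n \<and> i \<in> S} = S" using S by auto
  have fin: "finite S" using S finite_subset by blast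
  note bij = bij_betw_pick[OF fin]
  have "(submatrix A S S *\<^sub>v vec (card S) (\<lambda>k. z (pick S k))) $ i
    = (\<Sum>k = 0..<card S. A $$ (pick S i, pick S k) * z (pick S k))"
    using A i by (simp add: submatrix_def S' scalar_prod_def)
  also have "\<dots> = (\<Sum>j\<in>S. A $$ (pick S i, j) * z j)"
    by (rule sum.reindex_bij_betw[OF bij])
  finally show ?thesis .
qed

text \<open>Lets an eigenvector be given as a function \<open>z\<close> on the original vertex
  labels, so that the main argument never mentions \<open>pick\<close>. Values of \<open>z\<close>
  outside \<open>S\<close> do not matter, and \<open>i0\<close> witnesses that the vector is
  nonzero.\<close>

lemma eigenvalue_submatrixI:
  fixes A :: "'a :: field mat"
  assumes A: "A \<in> carrier_mat n n" and S: "S \<subseteq> {0..<n}"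
    and eq: "\<And>i. i \<in> S \<Longrightarrow> (\<Sum>j\<in>S. A $$ (i, j) * z j) = e * z i"
    and i0: "i0 \<in> S" "z i0 \<noteq> 0"
  shows "eigenvalue (submatrix A S S) e"
proof -
  have S': "{i. i < n \<and> i \<in> S} = S" using S by auto
  have fin: "finite S" using S finite_subset by blast
  have dim: "dim_row (submatrix A S S) = card S"
    using A by (simp add: submatrix_def S')
  define v where "v = vec (card S) (\<lambda>k. z (pick S k))"
  obtain k where "k < card S" "pick S k = i0"
    using bij_betw_pick[OF fin] i0 by (metis atLeastLessThan_iff bij_betw_iff_bijections)
  then have "v $ k \<noteq> 0\<^sub>v (card S) $ k"
    using i0 by (simp add: v_def)
  then have "v \<noteq> 0\<^sub>v (card S)" by auto
  moreover have "submatrix A S S *\<^sub>v v = e \<cdot>\<^sub>v v"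
  proof (rule eq_vecI)
    fix i assume "i < dim_vec (e \<cdot>\<^sub>v v)"
    then have i: "i < card S" by (simp add: v_def)
    show "(submatrix A S S *\<^sub>v v) $ i = (e \<cdot>\<^sub>v v) $ i"
      using sum_submatrix_row[OF A S i, of z] eq[OF pick_in_set_le[OF i]] i
      by (simp add: v_def)
  qed (simp add: v_def dim)
  ultimately show ?thesis
    unfolding eigenvalue_def eigenvector_def dim by (intro exI[of _ v]) (simp add: v_def)
qed

lemma smult_one_mat_mult_vec:
  fixes x :: "'a :: comm_semiring_1 vec"
  assumes "x \<in> carrier_vec n"
  shows "(c \<cdot>\<^sub>m 1\<^sub>m n) *\<^sub>v x = c \<cdot>\<^sub>v x"
proof (rule eq_vecI)
  fix i assume "i < dim_vec (c \<cdot>\<^sub>v x)"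
  then have i: "i < n" using assms by simp
  have "((c \<cdot>\<^sub>m 1\<^sub>m n) *\<^sub>v x) $ i = (c \<cdot>\<^sub>v row (1\<^sub>m n) i) \<bullet> x"
    using i by simp
  also have "\<dots> = c * (row (1\<^sub>m n) i \<bullet> x)"
    using i assms by (intro smult_scalar_prod_distrib) auto
  finally show "((c \<cdot>\<^sub>m 1\<^sub>m n) *\<^sub>v x) $ i = (c \<cdot>\<^sub>v x) $ i"
    using i assms by simp
qed (use assms in simp)

lemma KKT_stationary_on_supp:
  assumes A: "A \<in> carrier_mat n n" and x: "x \<in> KKT n A c"
  obtains k where "\<And>i. i \<in> vec_supp x \<Longrightarrow> (\<Sum>j\<in>vec_supp x. A $$ (i, j) * x $ j) + c * x $ i = k"
proof -
  from x obtain \<mu>0 \<mu> where xn: "x \<in> carrier_vec n" and mu: "\<mu> \<in> carrier_vec n"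
    and eq: "2 \<cdot>\<^sub>v ((A + c \<cdot>\<^sub>m 1\<^sub>m n) *\<^sub>v x) + \<mu>0 \<cdot>\<^sub>v all_ones n + \<mu> = 0\<^sub>v n"
    and slack: "\<And>i. i < n \<Longrightarrow> \<mu> $ i * x $ i = 0"
    unfolding KKT_def standard_simplex_def by auto
  \<comment> \<open>Half of row \<open>i\<close> of the stationarity equation, where complementary
    slackness removes the multiplier of \<open>i\<close>.\<close>
  have "(\<Sum>j\<in>vec_supp x. A $$ (i, j) * x $ j) + c * x $ i = - \<mu>0 / 2" if "i \<in> vec_supp x" for i
  proof -
    have i: "i < n" and mui: "\<mu> $ i = 0"
      using that xn slack by (auto simp: vec_supp_def)
    have "(A + c \<cdot>\<^sub>m 1\<^sub>m n) *\<^sub>v x = A *\<^sub>v x + c \<cdot>\<^sub>v x"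
      using A xn by (simp add: add_mult_distrib_mat_vec[of _ n n] smult_one_mat_mult_vec)
    then have "2 * ((A *\<^sub>v x) $ i + c * x $ i) + \<mu>0 = 0"
      using arg_cong[OF eq, of "\<lambda>v. v $ i"] i mu mui xn A by (simp add: all_ones_def)
    moreover have "(A *\<^sub>v x) $ i = (\<Sum>j = 0..<n. A $$ (i, j) * x $ j)"
      using A xn i by (simp add: scalar_prod_def)
    \<comment> \<open>Columns outside the support carry a zero entry of \<open>x\<close>.\<close>
    moreover have "\<dots> = (\<Sum>j\<in>vec_supp x. A $$ (i, j) * x $ j)"
      using xn by (intro sum.mono_neutral_right) (auto simp: vec_supp_def)
    ultimately show ?thesis by simp
  qed
  then show ?thesis by (rule that)
qed

text \<open>Since \<open>f\<close> maps \<open>S\<close> into itself, both pairs lie inside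
  \<open>S\<close>, where \<open>G\<close> and its induced subgraph have the same edges.\<close>

lemma graph_automorphism_adjacency:
  assumes f: "graph_automorphism (induced_subgraph G S) f" and "S \<subseteq> {0..<n}"
    and "i \<in> S" "j \<in> S"
  shows "adjacency_matrix n G $$ (f i, f j) = adjacency_matrix n G $$ (i, j)"
proof -
  have "f i \<in> S" "f j \<in> S"
    using f assms(3,4) by (auto simp: graph_automorphism_def induced_subgraph_def bij_betw_def)
  then have "{f i, f j} \<in> edges G \<longleftrightarrow> {i, j} \<in> edges G"
    using f assms(3,4) by (auto simp: graph_automorphism_def induced_subgraph_def)
  moreover have "i < n" "j < n" "f i < n" "f j < n"
    using assms(2-4) \<open>f i \<in> S\<close> \<open>f j \<in> S\<close> by auto
  ultimately show ?thesis by (simp add: adjacency_matrix_def)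
qed

theorem theorem2:
  fixes n :: nat and G :: "nat graph" and A :: "real mat" and c :: real
    and S :: "nat set" and x :: "real vec"
  assumes "n \<ge> 1"
    and "simple_graph G" and "vertices G = {0..<n}"
    and "A = adjacency_matrix n G"
    and "S \<subseteq> vertices G" and "S \<noteq> {}"
    and "x \<in> KKT n A c" and "S = vec_supp x"
    and "\<not> eigenvalue (submatrix A S S) (- c)"
  shows "\<forall>C \<in> induced_partition x. \<forall>f. graph_automorphism (induced_subgraph G S) f \<longrightarrow> f ` C = C"
proof (intro ballI allI impI)
  fix C f
  assume C: "C \<in> induced_partition x" and f: "graph_automorphism (induced_subgraph G S) f"
  have A: "A \<in> carrier_mat n n" using assms(4) by (simp add: adjacency_matrix_def)
  have S: "S \<subseteq> {0..<n}" using assms(3,5) by simp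
  have bij: "bij_betw f S S"
    using f by (simp add: graph_automorphism_def induced_subgraph_def)
  then have fS: "f i \<in> S" if "i \<in> S" for i using that by (auto simp: bij_betw_def)
  obtain k where k: "\<And>i. i \<in> S \<Longrightarrow> (\<Sum>j\<in>S. A $$ (i, j) * x $ j) + c * x $ i = k"
    using KKT_stationary_on_supp[OF A assms(7)] assms(8) by metis
  \<comment> \<open>Rows \<open>i\<close> and \<open>f i\<close> of the stationarity system share
    the right-hand side \<open>k\<close>, which cancels in the difference. Invariance of the
    adjacency matrix and reindexing by \<open>f\<close> turn the permuted row \<open>i\<close> into
    row \<open>f i\<close>.\<close>
  have eq: "(\<Sum>j\<in>S. A $$ (i, j) * (x $ f j - x $ j)) = - c * (x $ f i - x $ i)" if i: "i \<in> S" for i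
  proof -
    have "(\<Sum>j\<in>S. A $$ (i, j) * x $ f j) = (\<Sum>j\<in>S. A $$ (f i, f j) * x $ f j)"
      using graph_automorphism_adjacency[OF f S i] assms(4) by simp
    also have "\<dots> = (\<Sum>j\<in>S. A $$ (f i, j) * x $ j)"
      by (rule sum.reindex_bij_betw[OF bij])
    finally show ?thesis
      using k[OF i] k[OF fS[OF i]] by (simp add: right_diff_distrib sum_subtractf)
  qed
  \<comment> \<open>Otherwise the difference of the two solutions would be an eigenvector of
    \<open>submatrix A S S\<close> for \<open>- c\<close>.\<close>
  have fix_x: "x $ f i = x $ i" if "i \<in> S" for i
  proof (rule ccontr)
    assume "x $ f i \<noteq> x $ i"
    then show False
      using eigenvalue_submatrixI[OF A S, of "\<lambda>j. x $ f j - x $ j" "- c" i] eq that assms(9) by auto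
  qed
  obtain i where "C = {j \<in> S. x $ j = x $ i}"
  proof -
    obtain i where "i \<in> S" "C = {(i, j) \<in> S \<times> S. x $ i = x $ j} `` {i}"
      using C assms(8) by (auto simp: induced_partition_def elim: quotientE)
    then have "C = {j \<in> S. x $ j = x $ i}" by auto
    then show thesis by (rule that)
  qed
  \<comment> \<open>Equality, not just inclusion: the preimage in \<open>S\<close> of a point of the
    level set has the same value of \<open>x\<close>, hence lies in it too.\<close>
  moreover have "f ` {j \<in> S. x $ j = a} = {j \<in> S. x $ j = a}" for a
    using bij fix_x by (force simp: bij_betw_def)
  ultimately show "f ` C = C" by simp
qed

end
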